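(* Let $m,p\in\mathbb N$ with $p\neq 1$ and put $n=mp^2$. Then the Hadamard matrices $\mathcal F_n$ and $\mathcal F_{mp}\otimes\mathcal F_p$, both of size $n$ and order $n$, are not strongly quantum equivalent. Hence they are also not $n$-quantum equivalent.
   Context: A (complex) Hadamard matrix of size $n$ is $H\in M_n(\mathbb C)$ with entries of modulus one and $HH^\dagger=nI$. It is of order $s\in\mathbb N$ if all its entries are $s$-th roots of unity. The Fourier matrix is $\mathcal F_n=(\omega^{ij})_{i,j=0}^{n-1}$, where $\omega$ is a primitive $n$-th root of unity; $\otimes$ is the Kronecker product. For a unital $*$-algebra $\mathcal A$, a matrix $u=(u_{ij})\in M_n(\mathcal A)$ is a complex quantum reflection matrix if $u$ and $\bar u=(u_{ij}^* )$ are unitary and each $u_{ij}$ is a normal partial isometry; for $s\in\mathbb N$ it is an order-$s$ quantum reflection matrix if in addition $u_{ij}^s=u_{ij}u_{ij}^*$ for all $i,j$. Hadamard matrices $H,H'$ of size $n$ are strongly quantum equivalent if there are a non-zero unital $C^*$-algebra $\mathcal A$ and complex quantum reflection matrices $p,q\in M_n(\mathcal A)$ with $H'q=pH$. They are $s$-quantum equivalent if such $p,q$ exist that are order-$s$ quantum reflection matrices. *)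

theory Defs
  imports Complex_Main "Jordan_Normal_Form.Schur_Decomposition"
begin

section \<open>Unital star-algebras and C-star-algebras\<close>

text \<open>A unital complex star-algebra; the zero algebra is not excluded.\<close>

class unital_star_algebra = ring + monoid_mult +
  fixes scaleC :: "complex \<Rightarrow> 'a \<Rightarrow> 'a"
    and star :: "'a \<Rightarrow> 'a"
  assumes scaleC_add_right: "scaleC c (x + y) = scaleC c x + scaleC c y"
    and scaleC_add_left: "scaleC (c + d) x = scaleC c x + scaleC d x"
    and scaleC_scaleC: "scaleC c (scaleC d x) = scaleC (c * d) x"
    and scaleC_one: "scaleC 1 x = x"
    and mult_scaleC_left: "scaleC c x * y = scaleC c (x * y)"
    and mult_scaleC_right: "x * scaleC c y = scaleC c (x * y)"
    and star_add: "star (x + y) = star x + star y"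
    and star_scaleC: "star (scaleC c x) = scaleC (cnj c) (star x)"
    and star_mult: "star (x * y) = star y * star x"
    and star_star: "star (star x) = x"

text \<open>
  A non-zero unital C-star-algebra: non-zeroness is the axiom \<open>0 \<noteq> 1\<close> contained in
  \<^class>\<open>real_normed_algebra_1\<close>. Its axiom \<open>norm 1 = 1\<close> is no restriction, because it
  follows from the C-star-identity in a non-zero algebra.
\<close>

class cstar_algebra = unital_star_algebra + real_normed_algebra_1 + banach +
  assumes scaleC_of_real: "scaleC (complex_of_real r) x = scaleR r x"
    and norm_scaleC: "norm (scaleC c x) = cmod c * norm x"
    and cstar_identity: "norm (star x * x) = (norm x)^2"

instantiation complex :: cstar_algebra
begin

definition scaleC_complex :: "complex \<Rightarrow> complex \<Rightarrow> complex"
  where "scaleC_complex c x = c * x"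

definition star_complex :: "complex \<Rightarrow> complex"
  where "star_complex x = cnj x"

instance
  by standard
    (auto simp: scaleC_complex_def star_complex_def algebra_simps scaleR_conv_of_real
      norm_mult power2_eq_square)

end

section \<open>Hadamard matrices\<close>

definition hadamard :: "nat \<Rightarrow> complex mat \<Rightarrow> bool"
  where "hadamard n H \<longleftrightarrow> H \<in> carrier_mat n n \<and>
    (\<forall>i<n. \<forall>j<n. cmod (H $$ (i, j)) = 1) \<and>
    H * mat_adjoint H = of_nat n \<cdot>\<^sub>m 1\<^sub>m n"

definition hadamard_of_order :: "nat \<Rightarrow> nat \<Rightarrow> complex mat \<Rightarrow> bool"
  where "hadamard_of_order s n H \<longleftrightarrow> hadamard n H \<and> (\<forall>i<n. \<forall>j<n. (H $$ (i, j)) ^ s = 1)"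

definition primitive_root_of_unity :: "nat \<Rightarrow> complex \<Rightarrow> bool"
  where "primitive_root_of_unity n w \<longleftrightarrow> n > 0 \<and> w ^ n = 1 \<and> (\<forall>k. 0 < k \<and> k < n \<longrightarrow> w ^ k \<noteq> 1)"

definition fourier_mat :: "nat \<Rightarrow> complex \<Rightarrow> complex mat"
  where "fourier_mat n w = mat n n (\<lambda>(i, j). w ^ (i * j))"

definition kronecker :: "'b::times mat \<Rightarrow> 'b mat \<Rightarrow> 'b mat"  (infixl \<open>\<otimes>\<^sub>K\<close> 70)
  where "A \<otimes>\<^sub>K B = mat (dim_row A * dim_row B) (dim_col A * dim_col B)
    (\<lambda>(i, j). A $$ (i div dim_row B, j div dim_col B) * B $$ (i mod dim_row B, j mod dim_col B))"

section \<open>Quantum reflection matrices\<close>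

definition star_adjoint :: "'a::unital_star_algebra mat \<Rightarrow> 'a mat"
  where "star_adjoint u = map_mat star (transpose_mat u)"

definition unitary_matrix :: "nat \<Rightarrow> 'a::unital_star_algebra mat \<Rightarrow> bool"
  where "unitary_matrix n u \<longleftrightarrow> u \<in> carrier_mat n n \<and>
    u * star_adjoint u = 1\<^sub>m n \<and> star_adjoint u * u = 1\<^sub>m n"

definition normal_element :: "'a::unital_star_algebra \<Rightarrow> bool"
  where "normal_element x \<longleftrightarrow> x * star x = star x * x"

definition partial_isometry :: "'a::unital_star_algebra \<Rightarrow> bool"
  where "partial_isometry x \<longleftrightarrow> x * star x * x = x"

definition complex_quantum_reflection :: "nat \<Rightarrow> 'a::unital_star_algebra mat \<Rightarrow> bool"
  where "complex_quantum_reflection n u \<longleftrightarrow>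
    unitary_matrix n u \<and> unitary_matrix n (map_mat star u) \<and>
    (\<forall>i<n. \<forall>j<n. normal_element (u $$ (i, j)) \<and> partial_isometry (u $$ (i, j)))"

definition order_quantum_reflection :: "nat \<Rightarrow> nat \<Rightarrow> 'a::unital_star_algebra mat \<Rightarrow> bool"
  where "order_quantum_reflection s n u \<longleftrightarrow> complex_quantum_reflection n u \<and>
    (\<forall>i<n. \<forall>j<n. (u $$ (i, j)) ^ s = u $$ (i, j) * star (u $$ (i, j)))"

section \<open>Quantum equivalence of Hadamard matrices\<close>

text \<open>Scalar matrices, embedded entrywise along \<open>c \<mapsto> c \<cdot> 1\<close>.\<close>

definition scalar_mat :: "complex mat \<Rightarrow> 'a::unital_star_algebra mat"
  where "scalar_mat H = map_mat (\<lambda>c. scaleC c 1) H"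

text \<open>
  HOL cannot quantify over types inside a formula, so the C-star-algebra is a type parameter:
  the matrices are equivalent in the sense of the literature iff the predicate holds for some type
  of class \<^class>\<open>cstar_algebra\<close>. Inequivalence is the negation for every such type, that is,
  for a free type variable.
\<close>

definition strongly_quantum_equivalent ::
    "'a::cstar_algebra itself \<Rightarrow> nat \<Rightarrow> complex mat \<Rightarrow> complex mat \<Rightarrow> bool"
  where "strongly_quantum_equivalent _ n H H' \<longleftrightarrow>
    (\<exists>p q :: 'a mat. complex_quantum_reflection n p \<and> complex_quantum_reflection n q \<and>
      scalar_mat H' * q = p * scalar_mat H)"

definition quantum_equivalent ::
    "'a::cstar_algebra itself \<Rightarrow> nat \<Rightarrow> nat \<Rightarrow> complex mat \<Rightarrow> complex mat \<Rightarrow> bool"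
  where "quantum_equivalent _ s n H H' \<longleftrightarrow>
    (\<exists>p q :: 'a mat. order_quantum_reflection s n p \<and> order_quantum_reflection s n q \<and>
      scalar_mat H' * q = p * scalar_mat H)"

end

(* The entries in a row of p (in a column of q) are normal partial isometries whose support
   projections sum to 1. In a C-star-algebra such projections are mutually orthogonal, so k-th
   powers of the entries of H' q = p H yield the same relation between the entrywise k-th powers of
   all four matrices. For k = m p every entry of the power of H' is 1, hence both sides have constant
   columns; the value T_j in column j is unitary, as a sum of normal partial isometries with
   orthogonal supports. The columns 0 and 1 of the power of the Fourier matrix H are orthogonal,
   which forces n T_0^* T_1 = 0, a contradiction. *)

theory Submission
  imports Defs
begin

section \<open>Powers of primitive roots of unity\<close>

section \<open>Roots of unity\<close>

lemma sum_powers_root_of_unity: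
  fixes z :: "'a::field"
  assumes "z ^ n = 1" and "z \<noteq> 1"
  shows "(\<Sum>k<n. z ^ k) = 0"
  using geometric_sum[OF \<open>z \<noteq> 1\<close>, of n] assms by simp

lemma primitive_root_of_unity_inj_on:
  assumes "primitive_root_of_unity n w"
  shows "inj_on (\<lambda>k. w ^ k) {..<n}"
proof -
  have nz: "w \<noteq> 0"
    using assms by (auto simp: primitive_root_of_unity_def power_0_left)
  have "w ^ i \<noteq> w ^ j" if "i < j" "j < n" for i j
  proof
    assume "w ^ i = w ^ j"
    moreover have "w ^ i * w ^ (j - i) = w ^ j"
      using that by (simp flip: power_add)
    ultimately have "w ^ i * w ^ (j - i) = w ^ i * 1"
      by simp
    then have "w ^ (j - i) = 1"
      using nz by simp
    then show False
      using assms that by (auto simp: primitive_root_of_unity_def)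
  qed
  then show ?thesis
    by (intro linorder_inj_onI) auto
qed

lemma primitive_root_of_unity_cis:
  assumes "n > 0"
  shows "primitive_root_of_unity n (cis (2 * pi / n))"
proof -
  let ?f = "\<lambda>k. cis (2 * pi * real k / real n)"
  have inj: "inj_on ?f {..<n}"
    using bij_betw_roots_unity[OF assms] by (rule bij_betw_imp_inj_on)
  have "cis (2 * pi / n) ^ k = ?f k" for k
    by (simp add: DeMoivre mult_ac)
  moreover have "?f k \<noteq> ?f 0" if "0 < k" "k < n" for k
    using inj_onD[OF inj, of k 0] that by auto
  ultimately show ?thesis
    using assms by (simp add: primitive_root_of_unity_def)
qed

lemma root_of_unity_norm:
  fixes w :: complex
  assumes "w ^ n = 1" and "n > 0"
  shows "cmod w = 1"
  using assms by (metis norm_ge_zero norm_one norm_power power_eq_1_iff zero_less_iff_neq_zero)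

lemma cnj_unimodular:
  assumes "cmod z = 1"
  shows "z * cnj z = 1"
  using assms by (simp add: complex_norm_square[symmetric])

section \<open>Algebraic rules for \<open>star\<close> and \<open>scaleC\<close>\<close>

section \<open>Calculus in C-star-algebras\<close>

interpretation scaleC: vector_space "scaleC :: complex \<Rightarrow> 'a \<Rightarrow> 'a::unital_star_algebra"
  by standard (simp_all add: scaleC_add_right scaleC_add_left scaleC_scaleC scaleC_one)

lemma star_zero [simp]: "star (0 :: 'a::unital_star_algebra) = 0"
  by (metis star_add add_cancel_left_left)

lemma star_minus: "star (- x) = - star (x :: 'a::unital_star_algebra)"
  by (metis star_add star_zero add_eq_0_iff2 add.right_inverse)

lemma star_diff: "star (x - y) = star x - star (y :: 'a::unital_star_algebra)"
  by (metis star_add star_minus diff_conv_add_uminus)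

lemma star_one [simp]: "star (1 :: 'a::unital_star_algebra) = 1"
  by (metis star_mult star_star mult_1_left mult_1_right)

lemma star_sum: "star (sum f A) = (\<Sum>i\<in>A. star (f i :: 'a::unital_star_algebra))"
  by (induction A rule: infinite_finite_induct) (simp_all add: star_add)

lemma star_power: "star (x ^ k) = star (x :: 'a::unital_star_algebra) ^ k"
  by (induction k) (simp_all add: star_mult power_commutes)

section \<open>Norm estimates for polynomials and extreme points of the unit ball\<close>

text \<open>Cauchy's integral formula with the circle replaced by finitely many equally spaced
  points: averaging the polynomial against a power of the node isolates one coefficient, and an
  average of values bounded by \<open>C\<close> is again bounded by \<open>C\<close>.\<close>

lemma Cauchy_estimate:
  fixes d :: "nat \<Rightarrow> 'a::cstar_algebra"
  assumes "0 \<le> r" and "j \<le> N"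
    and bound: "\<And>z. cmod z = r \<Longrightarrow> norm (\<Sum>k\<le>N. scaleC (z ^ k) (d k)) \<le> C"
  shows "r ^ j * norm (d j) \<le> C"
proof -
  \<comment> \<open>One more node than the degree, so that distinct exponents up to \<open>N\<close>
    stay distinct modulo \<open>K\<close>.\<close>
  define K where "K = Suc N"
  define w where "w = cis (2 * pi / K)"
  have prim: "primitive_root_of_unity K w"
    unfolding w_def by (rule primitive_root_of_unity_cis) (simp add: K_def)
  have wK: "w ^ K = 1"
    using prim by (simp add: primitive_root_of_unity_def)
  \<comment> \<open>Discrete orthogonality. The exponent \<open>K - j\<close> plays the role of
    \<open>- j\<close>, since \<open>w ^ K = 1\<close>; the sum is geometric in
    \<open>z = w ^ (K - j + k)\<close>, which is 1 only for \<open>k = j\<close>.\<close>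
  have coeff: "(\<Sum>s<K. (w ^ s) ^ (K - j) * (w ^ s) ^ k) = (if k = j then of_nat K else 0)"
    if "k \<le> N" for k
  proof -
    define z where "z = w ^ (K - j + k)"
    have z: "(w ^ s) ^ (K - j) * (w ^ s) ^ k = z ^ s" for s
      by (simp add: z_def algebra_simps flip: power_add power_mult)
    have "z * w ^ j = w ^ (K + k)"
      using \<open>j \<le> N\<close> by (simp add: z_def K_def flip: power_add)
    also have "\<dots> = w ^ k"
      using wK by (simp add: power_add)
    finally have zk: "z * w ^ j = w ^ k" .
    have "w \<noteq> 0"
      by (simp add: w_def)
    then have "z = 1 \<longleftrightarrow> k = j"
      using zk inj_onD[OF primitive_root_of_unity_inj_on[OF prim], of j k] that \<open>j \<le> N\<close>
      by (auto simp: K_def)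
    moreover have "z ^ K = 1"
      using wK by (metis z_def power_mult mult.commute power_one)
    ultimately show ?thesis
      unfolding z using sum_powers_root_of_unity[of z K] by auto
  qed
  let ?S = "\<Sum>s<K. scaleC ((w ^ s) ^ (K - j)) (\<Sum>k\<le>N. scaleC ((of_real r * w ^ s) ^ k) (d k))"
  have "?S = (\<Sum>s<K. \<Sum>k\<le>N. scaleC ((w ^ s) ^ (K - j) * (w ^ s) ^ k) (scaleC (of_real r ^ k) (d k)))"
    by (simp add: scaleC.scale_sum_right power_mult_distrib mult_ac)
  also have "\<dots> = (\<Sum>k\<le>N. scaleC (\<Sum>s<K. (w ^ s) ^ (K - j) * (w ^ s) ^ k) (scaleC (of_real r ^ k) (d k)))"
    by (subst sum.swap) (simp only: scaleC.scale_sum_left)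
  also have "\<dots> = (\<Sum>k\<le>N. if k = j then scaleC (of_nat K) (scaleC (of_real r ^ k) (d k)) else 0)"
    by (intro sum.cong) (auto simp: coeff)
  also have "\<dots> = scaleC (of_nat K * of_real r ^ j) (d j)"
    using \<open>j \<le> N\<close> by simp
  finally have S: "?S = scaleC (of_nat K * of_real r ^ j) (d j)" .
  have "norm ?S \<le> of_nat (card {..<K}) * C"
  proof (rule sum_norm_bound)
    fix s
    have "cmod (w ^ s) = 1"
      by (simp add: w_def norm_power)
    then show "norm (scaleC ((w ^ s) ^ (K - j)) (\<Sum>k\<le>N. scaleC ((of_real r * w ^ s) ^ k) (d k))) \<le> C"
      using bound[of "of_real r * w ^ s"] \<open>0 \<le> r\<close>
      by (simp add: norm_scaleC norm_mult norm_power)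
  qed
  then have "K * (r ^ j * norm (d j)) \<le> K * C"
    unfolding S using \<open>0 \<le> r\<close> by (simp add: norm_scaleC norm_mult norm_power mult_ac)
  then show ?thesis
    by (simp add: K_def del: of_nat_Suc)
qed

text \<open>Since \<open>e\<close> is a unit for \<open>b\<close>, the element
  \<open>e + z b\<close> behaves like \<open>1 + z b\<close> in the corner of \<open>e\<close>; only
  its constant and linear coefficients matter later. The exponent is a successor because the zeroth
  power would be 1 instead of \<open>e\<close>.\<close>

lemma power_expansion:
  fixes e b :: "'a::unital_star_algebra"
  assumes "e * e = e" and "e * b = b" and "b * e = b"
  shows "\<exists>d. d 0 = e \<and> d 1 = scaleC (of_nat (Suc N)) b \<and>
    (\<forall>z. (e + scaleC z b) ^ Suc N = (\<Sum>k\<le>Suc N. scaleC (z ^ k) (d k)))"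
proof (induction N)
  case 0
  show ?case
    by (intro exI[of _ "\<lambda>k. if k = 0 then e else b"]) simp
next
  case (Suc N)
  then obtain d where d: "d 0 = e" "d 1 = scaleC (of_nat (Suc N)) b"
    "\<And>z. (e + scaleC z b) ^ Suc N = (\<Sum>k\<le>Suc N. scaleC (z ^ k) (d k))"
    by blast
  \<comment> \<open>Coefficients after multiplying by \<open>e + z b\<close> on the right. The guard
    is needed because \<open>d\<close> is unspecified above \<open>Suc N\<close>.\<close>
  define d' where "d' k = (if k \<le> Suc N then d k * e else 0) +
    (case k of 0 \<Rightarrow> 0 | Suc l \<Rightarrow> d l * b)" for k
  have "(e + scaleC z b) ^ Suc (Suc N) = (\<Sum>k\<le>Suc (Suc N). scaleC (z ^ k) (d' k))" for z
  proof -
    have "(e + scaleC z b) ^ Suc (Suc N) = (\<Sum>k\<le>Suc N. scaleC (z ^ k) (d k)) * (e + scaleC z b)"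
      by (simp only: power_Suc2 flip: d(3))
    also have "\<dots> = (\<Sum>k\<le>Suc N. scaleC (z ^ k) (d k * e))
        + (\<Sum>k\<le>Suc N. scaleC (z ^ Suc k) (d k * b))"
      by (simp only: distrib_left sum_distrib_right mult_scaleC_left mult_scaleC_right
          scaleC.scale_sum_right scaleC.scale_scale power_Suc)
    also have "(\<Sum>k\<le>Suc N. scaleC (z ^ k) (d k * e))
        = (\<Sum>k\<le>Suc (Suc N). scaleC (z ^ k) (if k \<le> Suc N then d k * e else 0))"
      by simp
    also have "(\<Sum>k\<le>Suc N. scaleC (z ^ Suc k) (d k * b))
        = (\<Sum>k\<le>Suc (Suc N). scaleC (z ^ k) (case k of 0 \<Rightarrow> 0 | Suc l \<Rightarrow> d l * b))"
      by (subst (2) sum.atMost_Suc_shift) simp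
    finally show ?thesis
      by (simp only: d'_def scaleC_add_right sum.distrib)
  qed
  moreover have "d' 0 = e"
    using d(1) assms by (simp add: d'_def)
  moreover have "d' 1 = scaleC (of_nat (Suc N)) b + scaleC 1 b"
    using d(1,2) assms by (simp add: d'_def mult_scaleC_left scaleC_one del: of_nat_Suc)
  then have "d' 1 = scaleC (of_nat (Suc (Suc N))) b"
    by (simp only: of_nat_Suc add.commute flip: scaleC_add_left)
  ultimately show ?case
    by blast
qed

lemma norm_midpoint_le:
  fixes x y :: "'a::real_normed_vector"
  assumes "norm x \<le> 1" and "norm y \<le> 1" and "x + y = 2 *\<^sub>R c"
  shows "norm c \<le> 1"
  using norm_triangle_ineq[of x y] assms by simp

text \<open>A projection is an extreme point of the unit ball of its corner, in the directions of
  self-adjoint elements: boundedness of \<open>(e + z b) ^ N\<close> on a disc of fixed radius bounds its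
  linear coefficient \<open>N b\<close> independently of \<open>N\<close>.\<close>

lemma corner_extreme_point:
  fixes e b :: "'a::cstar_algebra"
  assumes e: "star e = e" "e * e = e"
    and b: "star b = b" "e * b = b" "b * e = b"
    and norms: "norm (e + b) \<le> 1" "norm (e - b) \<le> 1"
  shows "b = 0"
proof -
  have real: "norm (e + scaleR t b) \<le> 1" if "\<bar>t\<bar> \<le> 1" for t
  proof -
    have "e + scaleR t b = scaleR ((1 + t) / 2) (e + b) + scaleR ((1 - t) / 2) (e - b)"
      by (simp add: algebra_simps flip: scaleR_add_left) (simp flip: scaleR_add_left add: field_simps)
    also have "norm \<dots> \<le> (1 + t) / 2 * 1 + (1 - t) / 2 * 1"
      using that norms by (intro order_trans[OF norm_triangle_ineq] add_mono)
        (auto simp: mult_left_le)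
    finally show ?thesis
      by (simp add: field_simps)
  qed
  \<comment> \<open>By the C-star-identity it suffices to bound
    \<open>star ?x * ?x = e + c * c\<close>, which is the midpoint of the squares of
    \<open>e + c\<close> and \<open>e - c\<close>; these are controlled by the real case.\<close>
  have imag: "norm (e + scaleC (\<i> * of_real t) b) \<le> 1" if "\<bar>t\<bar> \<le> 1" for t
  proof -
    define c where "c = scaleR t b"
    have c: "star c = c" "e * c = c" "c * e = c"
      using b by (simp_all add: c_def star_scaleC mult_scaleC_left mult_scaleC_right flip: scaleC_of_real)
    let ?x = "e + scaleC (\<i> * of_real t) b" and ?y = "e + c" and ?z = "e - c"
    have "norm (?y * ?y) \<le> 1 * 1" "norm (?z * ?z) \<le> 1 * 1"
      using real[of t] real[of "- t"] that
      by (intro order_trans[OF norm_mult_ineq] mult_mono; simp add: c_def)+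
    moreover have "star ?x * ?x = e + c * c"
    proof -
      have "?x = e + scaleC \<i> c"
        by (simp add: c_def scaleC_scaleC flip: scaleC_of_real)
      then show ?thesis
        using c e by (simp add: star_add star_scaleC algebra_simps mult_scaleC_left
            mult_scaleC_right scaleC.scale_right_diff_distrib)
    qed
    moreover have "?y * ?y + ?z * ?z = scaleR 2 (e + c * c)"
      using c e by (simp add: algebra_simps scaleR_2)
    ultimately have "norm (star ?x * ?x) \<le> 1"
      using norm_midpoint_le[of "?y * ?y" "?z * ?z"] by simp
    then show ?thesis
      by (simp add: cstar_identity abs_square_le_1)
  qed
  \<comment> \<open>Radius 1/2 keeps \<open>2 * Re z\<close> and \<open>2 * Im z\<close> in the
    interval from -1 to 1, and \<open>e + z b\<close> is the midpoint of the corresponding real and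
    imaginary points.\<close>
  have disc: "norm (e + scaleC z b) \<le> 1" if "cmod z = 1 / 2" for z
  proof (rule norm_midpoint_le)
    have "\<bar>Re z\<bar> \<le> 1 / 2" "\<bar>Im z\<bar> \<le> 1 / 2"
      using that abs_Re_le_cmod[of z] abs_Im_le_cmod[of z] by auto
    then show "norm (e + scaleR (2 * Re z) b) \<le> 1"
      "norm (e + scaleC (\<i> * of_real (2 * Im z)) b) \<le> 1"
      using real[of "2 * Re z"] imag[of "2 * Im z"] by auto
    have "scaleC (of_real (2 * Re z)) b + scaleC (\<i> * of_real (2 * Im z)) b = scaleC (of_real 2) (scaleC z b)"
      by (simp add: complex_eq_iff flip: scaleC_add_left)
    then show "e + scaleR (2 * Re z) b + (e + scaleC (\<i> * of_real (2 * Im z)) b)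
      = scaleR 2 (e + scaleC z b)"
      unfolding scaleC_of_real by (simp add: algebra_simps scaleR_2)
  qed
  have "real N * norm b \<le> 2" for N
  proof (cases N)
    case (Suc M)
    obtain d where d: "d 1 = scaleC (of_nat (Suc M)) b"
      "\<And>z. (e + scaleC z b) ^ Suc M = (\<Sum>k\<le>Suc M. scaleC (z ^ k) (d k))"
      using power_expansion[OF e(2) b(2,3), of M] by blast
    \<comment> \<open>The powers of \<open>e + z b\<close> stay in the unit ball on the circle of
      radius 1/2, and the linear coefficient is \<open>Suc M\<close> times \<open>b\<close>.\<close>
    have "(1 / 2) ^ 1 * norm (d 1) \<le> 1"
    proof (rule Cauchy_estimate)
      fix z :: complex assume "cmod z = 1 / 2"
      then show "norm (\<Sum>k\<le>Suc M. scaleC (z ^ k) (d k)) \<le> 1"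
        unfolding d(2)[symmetric] using disc[of z]
        by (intro order_trans[OF norm_power_ineq] power_le_one) auto
    qed simp_all
    then show ?thesis
      unfolding d(1) Suc by (simp add: norm_scaleC norm_of_nat del: of_nat_Suc)
  qed simp
  then show ?thesis
    using reals_Archimedean3[of "norm b"] by (metis norm_le_zero_iff not_le)
qed

section \<open>Projections that sum to one\<close>

lemma norm_projection_le:
  fixes e :: "'a::cstar_algebra"
  assumes "star e = e" and "e * e = e"
  shows "norm e \<le> 1"
proof -
  have "norm e * norm e = norm e * 1"
    using cstar_identity[of e] assms by (simp add: power2_eq_square)
  then show ?thesis
    by (metis mult_cancel_left order_refl zero_le_one)
qed

text \<open>Compressing the sum by \<open>e = P j\<close> gives elements \<open>a k\<close> with sum
  \<open>e\<close>; as \<open>a j = e\<close>, the others sum to 0. The bounds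
  \<open>norm (e - a k) \<le> 1\<close> stand in for positivity of the \<open>a k\<close>: they
  place \<open>e\<close> plus and minus a small multiple of \<open>a i\<close> in the unit ball, so
  extremality of \<open>e\<close> forces \<open>a i = 0\<close>.\<close>

lemma projections_orthogonal:
  fixes P :: "'i \<Rightarrow> 'a::cstar_algebra"
  assumes "finite I" and sum1: "(\<Sum>i\<in>I. P i) = 1"
    and star: "\<And>i. i \<in> I \<Longrightarrow> star (P i) = P i"
    and idem: "\<And>i. i \<in> I \<Longrightarrow> P i * P i = P i"
    and ij: "i \<in> I" "j \<in> I" "i \<noteq> j"
  shows "P i * P j = 0"
proof -
  define e where "e = P j"
  define a where "a k = e * P k * e" for k
  define J where "J = I - {j} - {i}"
  \<comment> \<open>Counts \<open>i\<close> and the indices in \<open>J\<close>; dividing by it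
    brings both bounds below to the unit ball.\<close>
  define N where "N = Suc (card J)"
  have e: "star e = e" "e * e = e"
    using ij star idem by (auto simp: e_def)
  have a: "star (a k) = a k" "e * a k = a k" "a k * e = a k" if "k \<in> I" for k
    using star[OF that] e by (auto simp: a_def star_mult mult.assoc) (simp flip: mult.assoc)
  have normle: "norm (e - a k) \<le> 1" if "k \<in> I" for k
  proof -
    have "star (1 - P k) = 1 - P k" "(1 - P k) * (1 - P k) = 1 - P k"
      using star[OF that] idem[OF that] by (simp_all add: star_diff algebra_simps)
    then have "norm (e * (1 - P k) * e) \<le> 1 * 1 * 1"
      by (intro order_trans[OF norm_mult_ineq] mult_mono norm_projection_le e) auto
    then show ?thesis
      by (simp add: a_def algebra_simps e)
  qed
  have "e + a i + (\<Sum>k\<in>J. a k) = (\<Sum>k\<in>I. a k)"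
    using assms(1) ij by (simp add: J_def sum.remove[of I j] sum.remove[of "I - {j}" i] a_def e
        e_def[symmetric] add.assoc)
  also have "\<dots> = e * (\<Sum>k\<in>I. P k) * e"
    by (simp add: a_def sum_distrib_left sum_distrib_right)
  finally have suma: "a i + (\<Sum>k\<in>J. a k) = 0"
    by (simp add: sum1 e add.assoc)
  have const: "norm (scaleR (real M) e) \<le> real M" for M
    using norm_projection_le[OF e] by (simp add: mult_left_le)
  have "norm (\<Sum>k\<in>J. e - a k) \<le> of_nat (card J) * 1"
    using normle by (intro sum_norm_bound) (auto simp: J_def)
  \<comment> \<open>The sum of \<open>a k\<close> over \<open>J\<close> is \<open>- a i\<close>, so
    subtracting it produces the plus sign.\<close>
  moreover have "(\<Sum>k\<in>J. e - a k) = scaleR (real (card J)) e + a i"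
    using minus_unique[OF suma] by (simp add: sum_subtractf sum_constant_scaleR del: sum_constant)
      (metis add.inverse_inverse diff_minus_eq_add)
  ultimately have plus: "norm (scaleR (real N) e + a i) \<le> real N"
    using norm_triangle_ineq[of e "scaleR (real (card J)) e + a i"] norm_projection_le[OF e]
    by (simp add: N_def scaleR_add_left add_ac)
  have minus: "norm (scaleR (real N) e - a i) \<le> real N"
    using norm_triangle_ineq[of "scaleR (real (card J)) e" "e - a i"] normle[of i] ij const[of "card J"]
    by (simp add: N_def scaleR_add_left algebra_simps)
  let ?b = "scaleR (1 / real N) (a i)"
  have "norm (e + ?b) \<le> 1" "norm (e - ?b) \<le> 1"
  proof -
    have N: "real N > 0" by (simp add: N_def)
    have "scaleR (real N) (e + ?b) = scaleR (real N) e + a i"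
      "scaleR (real N) (e - ?b) = scaleR (real N) e - a i"
      using N by (simp_all add: scaleR_add_right scaleR_diff_right)
    then have "real N * norm (e + ?b) \<le> real N * 1" "real N * norm (e - ?b) \<le> real N * 1"
      using plus minus by (metis norm_scaleR abs_of_nat mult_1_right)+
    then show "norm (e + ?b) \<le> 1" "norm (e - ?b) \<le> 1"
      using N by (simp_all only: mult_le_cancel_left_pos)
  qed
  moreover have "star ?b = ?b" "e * ?b = ?b" "?b * e = ?b"
    using a[of i] ij by (simp_all add: star_scaleC mult_scaleC_left mult_scaleC_right flip: scaleC_of_real)
  ultimately have "?b = 0"
    by (intro corner_extreme_point[OF e])
  then have "a i = 0"
    by (simp add: N_def)
  \<comment> \<open>Vanishing of the compression gives vanishing of the product, by the
    C-star-identity.\<close>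
  moreover have "star (P i * P j) * (P i * P j) = a i"
    using star idem ij by (simp add: star_mult a_def e_def mult.assoc) (simp flip: mult.assoc)
  ultimately show ?thesis
    using cstar_identity[of "P i * P j"] by simp
qed

section \<open>Powers and sums of normal partial isometries with orthogonal supports\<close>

section \<open>Orthogonal families of normal partial isometries\<close>

text \<open>Common abstraction of a row and of a column of a quantum reflection matrix. By normality
  the initial projection \<open>star (x i) * x i\<close> is also the final one, hence one resolution
  of the identity serves both sides.\<close>

locale partial_isometry_resolution =
  fixes I :: "'i set" and x :: "'i \<Rightarrow> 'a::cstar_algebra"
  assumes finite: "finite I"
    and normal: "i \<in> I \<Longrightarrow> normal_element (x i)"
    and partial_isometry: "i \<in> I \<Longrightarrow> partial_isometry (x i)"
    and resolution: "(\<Sum>i\<in>I. star (x i) * x i) = 1"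
begin

lemma star_resolution: "partial_isometry_resolution I (\<lambda>i. star (x i))"
proof
  show "normal_element (star (x i))" if "i \<in> I" for i
    using normal[OF that] by (simp add: normal_element_def star_star)
  show "partial_isometry (star (x i))" if "i \<in> I" for i
    using arg_cong[OF partial_isometry[OF that, unfolded partial_isometry_def], of star]
    by (simp add: partial_isometry_def star_star star_mult mult.assoc)
  have "(\<Sum>i\<in>I. star (star (x i)) * star (x i)) = (\<Sum>i\<in>I. star (x i) * x i)"
    using normal by (intro sum.cong) (simp_all add: normal_element_def star_star)
  then show "(\<Sum>i\<in>I. star (star (x i)) * star (x i)) = 1"
    by (simp add: resolution)
qed (rule finite)

text \<open>Normality makes the support projection a two-sided unit for \<open>x i\<close> and for
  its adjoint.\<close>

lemma support:
  assumes "i \<in> I"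
  shows "star (x i) * x i * x i = x i" "x i * (star (x i) * x i) = x i"
    "star (x i) * x i * star (x i) = star (x i)" "star (x i) * (star (x i) * x i) = star (x i)"
proof -
  have n: "x i * star (x i) = star (x i) * x i" and p: "x i * star (x i) * x i = x i"
    using normal[OF assms] partial_isometry[OF assms]
    by (auto simp: normal_element_def partial_isometry_def)
  show *: "star (x i) * x i * x i = x i" "x i * (star (x i) * x i) = x i"
    using n p by (metis mult.assoc)+
  show "star (x i) * x i * star (x i) = star (x i)" "star (x i) * (star (x i) * x i) = star (x i)"
    using arg_cong[OF *(2), of star] arg_cong[OF *(1), of star] by (simp_all add: star_mult star_star)
qed

lemma orthogonal_supports:
  assumes "i \<in> I" "j \<in> I" "i \<noteq> j"
  shows "(star (x i) * x i) * (star (x j) * x j) = 0"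
proof (rule projections_orthogonal[OF finite resolution])
  show "star (star (x k) * x k) = star (x k) * x k" if "k \<in> I" for k
    by (simp add: star_mult star_star)
  show "star (x k) * x k * (star (x k) * x k) = star (x k) * x k" if "k \<in> I" for k
    using support(2)[OF that] by (simp add: mult.assoc)
qed (use assms in auto)

text \<open>Insert the supports between the two factors; their product vanishes.\<close>

lemma orthogonal:
  assumes "i \<in> I" "j \<in> I" "i \<noteq> j"
  shows "x i * x j = 0" "star (x i) * x j = 0"
proof -
  have "y * z = 0" if "y * (star (x i) * x i) = y" "star (x j) * x j * z = z" for y z
  proof -
    have "y * z = y * ((star (x i) * x i) * (star (x j) * x j)) * z"
      using that by (metis mult.assoc)
    then show ?thesis
      by (simp only: orthogonal_supports[OF assms] mult_zero_left mult_zero_right)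
  qed
  then show "x i * x j = 0" "star (x i) * x j = 0"
    using support assms by blast+
qed

text \<open>Powers keep the support, which is why sums of powers are again unitary.\<close>

lemma support_power:
  assumes "i \<in> I"
  shows "star (x i ^ Suc k) * x i ^ Suc k = star (x i) * x i"
proof (induction k)
  case (Suc k)
  have "star (x i ^ Suc (Suc k)) * x i ^ Suc (Suc k)
      = star (x i) * (star (x i ^ Suc k) * x i ^ Suc k) * x i"
    by (simp only: power_Suc2[of _ "Suc k"] star_mult mult.assoc)
  also have "\<dots> = star (x i) * x i"
    by (simp only: Suc support(4)[OF assms])
  finally show ?case .
qed simp

text \<open>All mixed products vanish, so taking powers acts termwise. This fails for exponent 0,
  hence \<open>Suc k\<close>.\<close>

lemma sum_power:
  "(\<Sum>i\<in>I. scaleC (c i) (x i)) ^ Suc k = (\<Sum>i\<in>I. scaleC (c i ^ Suc k) (x i ^ Suc k))"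
proof (induction k)
  case (Suc k)
  have "(\<Sum>i\<in>I. scaleC (c i) (x i)) ^ Suc (Suc k)
      = (\<Sum>i\<in>I. scaleC (c i) (x i)) * (\<Sum>j\<in>I. scaleC (c j ^ Suc k) (x j ^ Suc k))"
    by (subst power_Suc) (simp only: Suc)
  also have "\<dots> = (\<Sum>i\<in>I. \<Sum>j\<in>I. scaleC (c i * c j ^ Suc k) (x i * x j ^ Suc k))"
    by (simp only: sum_product mult_scaleC_left mult_scaleC_right scaleC_scaleC mult.commute)
  also have "\<dots> = (\<Sum>i\<in>I. \<Sum>j\<in>I. if j = i then scaleC (c i ^ Suc (Suc k)) (x i ^ Suc (Suc k)) else 0)"
  proof (intro sum.cong refl)
    fix i j assume "i \<in> I" "j \<in> I"
    then have "x i * x j ^ Suc k = 0" if "j \<noteq> i"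
      using orthogonal(1)[of i j] that by (metis power_Suc mult.assoc mult_zero_left)
    then show "scaleC (c i * c j ^ Suc k) (x i * x j ^ Suc k)
        = (if j = i then scaleC (c i ^ Suc (Suc k)) (x i ^ Suc (Suc k)) else 0)"
      by auto
  qed
  also have "\<dots> = (\<Sum>i\<in>I. scaleC (c i ^ Suc (Suc k)) (x i ^ Suc (Suc k)))"
    using finite by (intro sum.cong) auto
  finally show ?case .
qed simp

lemma star_sum_mult_sum:
  "star (\<Sum>i\<in>I. scaleC (c i) (x i ^ Suc k)) * (\<Sum>i\<in>I. scaleC (d i) (x i ^ Suc k))
    = (\<Sum>i\<in>I. scaleC (cnj (c i) * d i) (star (x i) * x i))"
proof -
  have "star (\<Sum>i\<in>I. scaleC (c i) (x i ^ Suc k)) * (\<Sum>i\<in>I. scaleC (d i) (x i ^ Suc k))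
      = (\<Sum>i\<in>I. \<Sum>j\<in>I. scaleC (cnj (c i) * d j) (star (x i ^ Suc k) * x j ^ Suc k))"
    by (simp only: star_sum star_scaleC sum_product mult_scaleC_left mult_scaleC_right scaleC_scaleC mult.commute)
  also have "\<dots> = (\<Sum>i\<in>I. \<Sum>j\<in>I. if j = i then scaleC (cnj (c i) * d i) (star (x i) * x i) else 0)"
  proof (intro sum.cong refl)
    fix i j assume ij: "i \<in> I" "j \<in> I"
    have "star (x i ^ Suc k) * x j ^ Suc k = 0" if "j \<noteq> i"
    proof -
      have "star (x i ^ Suc k) * x j ^ Suc k = star (x i) ^ k * (star (x i) * x j) * x j ^ k"
        by (simp only: star_power power_Suc2[of "star (x i)"] power_Suc[of "x j"] mult.assoc)
      then show ?thesis
        using orthogonal(2)[OF ij] that by simp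
    qed
    then show "scaleC (cnj (c i) * d j) (star (x i ^ Suc k) * x j ^ Suc k)
        = (if j = i then scaleC (cnj (c i) * d i) (star (x i) * x i) else 0)"
      using support_power[OF ij(1), of k] by auto
  qed
  also have "\<dots> = (\<Sum>i\<in>I. scaleC (cnj (c i) * d i) (star (x i) * x i))"
    using finite by (intro sum.cong) auto
  finally show ?thesis .
qed

lemma star_sum_powers_mult:
  "star (\<Sum>i\<in>I. x i ^ Suc k) * (\<Sum>i\<in>I. x i ^ Suc k) = 1"
  using star_sum_mult_sum[of "\<lambda>_. 1" k "\<lambda>_. 1"] by (simp only: scaleC_one complex_cnj_one mult_1 resolution)

text \<open>The previous identity applied to the adjoint family, which is a resolution as
  well.\<close>

lemma sum_powers_mult_star:
  "(\<Sum>i\<in>I. x i ^ Suc k) * star (\<Sum>i\<in>I. x i ^ Suc k) = 1"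
proof -
  interpret star: partial_isometry_resolution I "\<lambda>i. star (x i)"
    by (rule star_resolution)
  show ?thesis
    using star.star_sum_powers_mult[of k] by (simp only: star_sum star_power star_star)
qed

end

section \<open>Rows and columns of quantum reflection matrices, and a criterion for
  inequivalence\<close>

lemma complex_quantum_reflection_row:
  fixes u :: "'a::cstar_algebra mat"
  assumes u: "complex_quantum_reflection n u" and "i < n"
  shows "partial_isometry_resolution {..<n} (\<lambda>k. u $$ (i, k))"
proof
  have carrier: "u \<in> carrier_mat n n" and eq: "u * star_adjoint u = 1\<^sub>m n"
    using u by (auto simp: complex_quantum_reflection_def unitary_matrix_def)
  have "(\<Sum>k<n. star (u $$ (i, k)) * u $$ (i, k)) = (\<Sum>k<n. u $$ (i, k) * star (u $$ (i, k)))"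
    using u \<open>i < n\<close> by (intro sum.cong) (auto simp: complex_quantum_reflection_def normal_element_def)
  also have "\<dots> = (u * star_adjoint u) $$ (i, i)"
    using carrier \<open>i < n\<close> by (auto simp: star_adjoint_def scalar_prod_def atLeast0LessThan intro!: sum.cong)
  finally show "(\<Sum>k<n. star (u $$ (i, k)) * u $$ (i, k)) = 1"
    using \<open>i < n\<close> by (simp add: eq)
qed (use u \<open>i < n\<close> in \<open>auto simp: complex_quantum_reflection_def\<close>)

lemma complex_quantum_reflection_column:
  fixes u :: "'a::cstar_algebra mat"
  assumes u: "complex_quantum_reflection n u" and "j < n"
  shows "partial_isometry_resolution {..<n} (\<lambda>k. u $$ (k, j))"
proof
  have carrier: "u \<in> carrier_mat n n" and eq: "star_adjoint u * u = 1\<^sub>m n"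
    using u by (auto simp: complex_quantum_reflection_def unitary_matrix_def)
  have "(\<Sum>k<n. star (u $$ (k, j)) * u $$ (k, j)) = (star_adjoint u * u) $$ (j, j)"
    using carrier \<open>j < n\<close> by (auto simp: star_adjoint_def scalar_prod_def atLeast0LessThan intro!: sum.cong)
  then show "(\<Sum>k<n. star (u $$ (k, j)) * u $$ (k, j)) = 1"
    using \<open>j < n\<close> by (simp add: eq)
qed (use u \<open>j < n\<close> in \<open>auto simp: complex_quantum_reflection_def\<close>)

text \<open>Separates the operator argument from the Fourier matrices: taking \<open>k\<close>-th
  powers turns \<open>H'\<close> into the all-ones matrix, and orthogonality of two columns of the
  powered \<open>H\<close> is then incompatible with unitarity of the column sums
  \<open>T\<close>.\<close>

lemma not_strongly_quantum_equivalent_if_power_ones: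
  fixes H H' :: "complex mat"
  assumes H: "H \<in> carrier_mat n n" and H': "H' \<in> carrier_mat n n"
    and ones: "\<And>i j. i < n \<Longrightarrow> j < n \<Longrightarrow> (H' $$ (i, j)) ^ k = 1" and "k > 0"
    and cols: "a < n" "b < n" "(\<Sum>l<n. cnj (H $$ (l, a) ^ k) * H $$ (l, b) ^ k) = 0"
  shows "\<not> strongly_quantum_equivalent TYPE('a::cstar_algebra) n H H'"
proof
  assume "strongly_quantum_equivalent TYPE('a) n H H'"
  then obtain p q :: "'a mat" where p: "complex_quantum_reflection n p"
    and q: "complex_quantum_reflection n q" and eq: "scalar_mat H' * q = p * scalar_mat H"
    unfolding strongly_quantum_equivalent_def by blast
  have pq: "p \<in> carrier_mat n n" "q \<in> carrier_mat n n"
    using p q by (auto simp: complex_quantum_reflection_def unitary_matrix_def)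
  obtain m where k: "k = Suc m"
    using \<open>k > 0\<close> by (cases k) auto
  \<comment> \<open>The entry in column \<open>j\<close> of the powered product; it is the same in
    every row \<open>i\<close>.\<close>
  define T where "T j = (\<Sum>l<n. q $$ (l, j) ^ k)" for j
  have T: "(\<Sum>l<n. scaleC (H $$ (l, j) ^ k) (p $$ (i, l) ^ k)) = T j" if "i < n" "j < n" for i j
  proof -
    interpret p: partial_isometry_resolution "{..<n}" "\<lambda>l. p $$ (i, l)"
      using p that by (intro complex_quantum_reflection_row)
    interpret q: partial_isometry_resolution "{..<n}" "\<lambda>l. q $$ (l, j)"
      using q that by (intro complex_quantum_reflection_column)
    have "(\<Sum>l<n. scaleC (H $$ (l, j)) (p $$ (i, l))) = (p * scalar_mat H) $$ (i, j)"
      using pq H that by (auto simp: scalar_mat_def scalar_prod_def atLeast0LessThan mult_scaleC_right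
          intro!: sum.cong)
    also have "\<dots> = (scalar_mat H' * q) $$ (i, j)"
      by (simp only: eq)
    also have "\<dots> = (\<Sum>l<n. scaleC (H' $$ (i, l)) (q $$ (l, j)))"
      using pq H' that by (auto simp: scalar_mat_def scalar_prod_def atLeast0LessThan mult_scaleC_left
          intro!: sum.cong)
    finally have "(\<Sum>l<n. scaleC (H $$ (l, j) ^ k) (p $$ (i, l) ^ k))
        = (\<Sum>l<n. scaleC (H' $$ (i, l) ^ k) (q $$ (l, j) ^ k))"
      unfolding k by (simp only: flip: p.sum_power q.sum_power)
    also have "\<dots> = T j"
      using ones that by (simp add: T_def scaleC_one)
    finally show ?thesis .
  qed
  \<comment> \<open>Summing the row-independent product over all rows allows the sums to be swapped,
    so that the supports in each column of \<open>p\<close> add up to 1 and only the scalar inner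
    product remains.\<close>
  have "scaleC (of_nat n) (star (T a) * T b) = (\<Sum>i<n. star (T a) * T b)"
    by (simp add: scaleC.sum_constant_scale del: sum_constant)
  also have "\<dots> = (\<Sum>i<n. \<Sum>l<n. scaleC (cnj (H $$ (l, a) ^ k) * H $$ (l, b) ^ k)
      (star (p $$ (i, l)) * p $$ (i, l)))"
  proof (intro sum.cong refl)
    fix i assume "i \<in> {..<n}"
    then interpret p: partial_isometry_resolution "{..<n}" "\<lambda>l. p $$ (i, l)"
      using p by (intro complex_quantum_reflection_row) auto
    show "star (T a) * T b = (\<Sum>l<n. scaleC (cnj (H $$ (l, a) ^ k) * H $$ (l, b) ^ k)
      (star (p $$ (i, l)) * p $$ (i, l)))"
      using \<open>i \<in> {..<n}\<close> cols T[of i a, symmetric] T[of i b, symmetric]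
        p.star_sum_mult_sum[where k = m, folded k] by simp
  qed
  also have "\<dots> = (\<Sum>l<n. scaleC (cnj (H $$ (l, a) ^ k) * H $$ (l, b) ^ k)
      (\<Sum>i<n. star (p $$ (i, l)) * p $$ (i, l)))"
    by (subst sum.swap) (simp only: scaleC.scale_sum_right)
  also have "\<dots> = (\<Sum>l<n. scaleC (cnj (H $$ (l, a) ^ k) * H $$ (l, b) ^ k) 1)"
    using complex_quantum_reflection_column[OF p]
    by (intro sum.cong) (simp_all add: partial_isometry_resolution.resolution)
  also have "\<dots> = 0"
    by (simp only: cols scaleC.scale_zero_left flip: scaleC.scale_sum_left)
  finally have orth: "star (T a) * T b = 0"
    using cols by simp
  interpret qa: partial_isometry_resolution "{..<n}" "\<lambda>l. q $$ (l, a)"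
    using q cols by (intro complex_quantum_reflection_column)
  interpret qb: partial_isometry_resolution "{..<n}" "\<lambda>l. q $$ (l, b)"
    using q cols by (intro complex_quantum_reflection_column)
  \<comment> \<open>\<open>T a\<close> is unitary, so it can be cancelled.\<close>
  have "T b = T a * star (T a) * T b"
    using qa.sum_powers_mult_star[of m] by (simp add: T_def k)
  also have "\<dots> = 0"
    by (simp only: mult.assoc orth mult_zero_right)
  finally have "star (T b) * T b = 0"
    by simp
  moreover have "star (T b) * T b = 1"
    unfolding T_def k by (rule qb.star_sum_powers_mult)
  ultimately show False
    by simp
qed

section \<open>The Hadamard property of Fourier matrices and Kronecker products\<close>

section \<open>Fourier matrices and Kronecker products\<close>

lemma hadamard_iff:
  "hadamard n H \<longleftrightarrow> H \<in> carrier_mat n n \<and> (\<forall>i<n. \<forall>j<n. cmod (H $$ (i, j)) = 1) \<and>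
    (\<forall>i<n. \<forall>j<n. (\<Sum>k<n. H $$ (i, k) * cnj (H $$ (j, k))) = (if i = j then of_nat n else 0))"
proof -
  have "H * mat_adjoint H = of_nat n \<cdot>\<^sub>m 1\<^sub>m n \<longleftrightarrow>
      (\<forall>i<n. \<forall>j<n. (\<Sum>k<n. H $$ (i, k) * cnj (H $$ (j, k))) = (if i = j then of_nat n else 0))"
    if H: "H \<in> carrier_mat n n"
  proof -
    have "(H * mat_adjoint H) $$ (i, j) = (\<Sum>k<n. H $$ (i, k) * cnj (H $$ (j, k)))"
      if "i < n" "j < n" for i j
      using H that by (auto simp: mat_adjoint_def mat_of_rows_def scalar_prod_def atLeast0LessThan
          intro!: sum.cong)
    moreover have "dim_row (H * mat_adjoint H) = n" "dim_col (H * mat_adjoint H) = n"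
      using H by (auto simp: mat_adjoint_def)
    ultimately show ?thesis
      by (auto simp: mat_eq_iff)
  qed
  then show ?thesis
    by (auto simp: hadamard_def)
qed

text \<open>The inner product of rows \<open>i\<close> and \<open>j\<close> is a geometric sum in
  the \<open>n\<close>-th root of unity \<open>w ^ i * cnj (w ^ j)\<close>, which equals 1 only on
  the diagonal.\<close>

lemma hadamard_fourier_mat:
  assumes "primitive_root_of_unity n w"
  shows "hadamard n (fourier_mat n w)"
proof -
  have w: "w ^ n = 1" "n > 0"
    using assms by (auto simp: primitive_root_of_unity_def)
  have norm: "cmod w = 1"
    by (rule root_of_unity_norm[OF w])
  have "(\<Sum>k<n. w ^ (i * k) * cnj (w ^ (j * k))) = (if i = j then of_nat n else 0)"
    if ij: "i < n" "j < n" for i j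
  proof -
    define z where "z = w ^ i * cnj (w ^ j)"
    have z: "w ^ (i * k) * cnj (w ^ (j * k)) = z ^ k" for k
      by (simp add: z_def power_mult power_mult_distrib)
    have unit: "w ^ j * cnj (w ^ j) = 1"
      by (rule cnj_unimodular) (simp add: norm norm_power)
    have "z ^ n = (w ^ n) ^ i * cnj ((w ^ n) ^ j)"
      by (simp add: z_def power_mult_distrib mult.commute flip: power_mult)
    then have "z ^ n = 1"
      by (simp add: w)
    moreover have "z = 1 \<longleftrightarrow> i = j"
    proof
      assume "z = 1"
      then have "w ^ i * (w ^ j * cnj (w ^ j)) = w ^ j"
        by (simp add: z_def mult_ac)
      then have "w ^ i = w ^ j"
        by (simp only: unit mult_1_right)
      then show "i = j"
        using inj_onD[OF primitive_root_of_unity_inj_on[OF assms]] ij by simp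
    qed (use unit in \<open>simp add: z_def\<close>)
    ultimately show ?thesis
      unfolding z using sum_powers_root_of_unity[of z n] by auto
  qed
  then show ?thesis
    by (simp add: hadamard_iff fourier_mat_def norm_power norm)
qed

text \<open>Split the range into \<open>a\<close> blocks of length \<open>b\<close>, on each of
  which the quotient is constant. This factors inner products of rows of a Kronecker
  product.\<close>

lemma sum_div_mod:
  fixes f g :: "nat \<Rightarrow> 'a::semiring_0"
  shows "(\<Sum>k<a * b. f (k div b) * g (k mod b)) = (\<Sum>k<a. f k) * (\<Sum>k<b. g k)"
proof -
  have "(\<Sum>k<a * b. f (k div b) * g (k mod b))
      = (\<Sum>i<a. \<Sum>k=i * b..<i * b + b. f (k div b) * g (k mod b))"
    by (rule sum.nat_group[symmetric])
  also have "\<dots> = (\<Sum>i<a. \<Sum>k<b. f i * g k)"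
  proof (rule sum.cong[OF refl])
    fix i
    show "(\<Sum>k=i * b..<i * b + b. f (k div b) * g (k mod b)) = (\<Sum>k<b. f i * g k)"
      by (rule sum.reindex_bij_witness[of _ "\<lambda>k. i * b + k" "\<lambda>k. k - i * b"])
        (auto simp: le_iff_add)
  qed
  finally show ?thesis
    by (simp add: sum_product)
qed

lemma hadamard_kronecker:
  assumes A: "hadamard a A" and B: "hadamard b B"
  shows "hadamard (a * b) (A \<otimes>\<^sub>K B)"
proof -
  have carrier: "A \<in> carrier_mat a a" "B \<in> carrier_mat b b"
    using A B by (auto simp: hadamard_iff)
  have bounds: "i div b < a \<and> i mod b < b" if "i < a * b" for i
    using that by (auto simp: less_mult_imp_div_less intro!: mod_less_divisor) (metis gr0I mult_0_right not_less0)
  have entry: "(A \<otimes>\<^sub>K B) $$ (i, j) = A $$ (i div b, j div b) * B $$ (i mod b, j mod b)"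
    if "i < a * b" "j < a * b" for i j
    using carrier that by (auto simp: kronecker_def)
  have "(\<Sum>k<a * b. (A \<otimes>\<^sub>K B) $$ (i, k) * cnj ((A \<otimes>\<^sub>K B) $$ (j, k)))
      = (if i = j then of_nat (a * b) else 0)" if "i < a * b" "j < a * b" for i j
  proof -
    have "(\<Sum>k<a * b. (A \<otimes>\<^sub>K B) $$ (i, k) * cnj ((A \<otimes>\<^sub>K B) $$ (j, k)))
        = (\<Sum>k<a * b. (A $$ (i div b, k div b) * cnj (A $$ (j div b, k div b)))
            * (B $$ (i mod b, k mod b) * cnj (B $$ (j mod b, k mod b))))"
      using that by (intro sum.cong) (simp_all add: entry mult_ac)
    also have "\<dots> = (\<Sum>k<a. A $$ (i div b, k) * cnj (A $$ (j div b, k)))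
        * (\<Sum>k<b. B $$ (i mod b, k) * cnj (B $$ (j mod b, k)))"
      by (rule sum_div_mod)
    also have "\<dots> = (if i div b = j div b then of_nat a else 0) * (if i mod b = j mod b then of_nat b else 0)"
      using A B bounds that by (auto simp: hadamard_iff)
    also have "\<dots> = (if i = j then of_nat (a * b) else 0)"
      by auto (metis div_mult_mod_eq)
    finally show ?thesis .
  qed
  then show ?thesis
    using carrier A B bounds by (auto simp: hadamard_iff entry norm_mult) (auto simp: kronecker_def)
qed

lemma fourier_mat_power:
  assumes "w ^ s = 1" and "i < n" and "j < n"
  shows "fourier_mat n w $$ (i, j) ^ s = 1"
proof -
  have "(w ^ (i * j)) ^ s = (w ^ s) ^ (i * j)"
    by (simp add: mult.commute flip: power_mult)
  then show ?thesis
    using assms by (simp add: fourier_mat_def)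
qed

lemma kronecker_power:
  fixes A B :: "'a::comm_monoid_mult mat"
  assumes "A \<in> carrier_mat a a" "B \<in> carrier_mat b b"
    and "\<And>i j. i < a \<Longrightarrow> j < a \<Longrightarrow> A $$ (i, j) ^ s = 1"
    and "\<And>i j. i < b \<Longrightarrow> j < b \<Longrightarrow> B $$ (i, j) ^ s = 1"
    and "i < a * b" "j < a * b"
  shows "(A \<otimes>\<^sub>K B) $$ (i, j) ^ s = 1"
proof -
  have "b > 0"
    using \<open>i < a * b\<close> by (cases b) auto
  then show ?thesis
    using assms by (simp add: kronecker_def power_mult_distrib less_mult_imp_div_less)
qed

section \<open>The two Hadamard matrices of size \<open>m * p^2\<close>\<close>

theorem proposition4p5:
  fixes m p n :: nat and w w' w'' :: complex
  assumes "m > 0" and "p > 0" and "p \<noteq> 1" and "n = m * p^2"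
    and "primitive_root_of_unity n w"
    and "primitive_root_of_unity (m * p) w'"
    and "primitive_root_of_unity p w''"
  shows "hadamard_of_order n n (fourier_mat n w)
    \<and> hadamard_of_order n n (fourier_mat (m * p) w' \<otimes>\<^sub>K fourier_mat p w'')
    \<and> \<not> strongly_quantum_equivalent TYPE('a::cstar_algebra) n
          (fourier_mat n w) (fourier_mat (m * p) w' \<otimes>\<^sub>K fourier_mat p w'')
    \<and> \<not> quantum_equivalent TYPE('a) n n
          (fourier_mat n w) (fourier_mat (m * p) w' \<otimes>\<^sub>K fourier_mat p w'')"
proof -
  let ?F = "fourier_mat n w" and ?K = "fourier_mat (m * p) w' \<otimes>\<^sub>K fourier_mat p w''"
  have n: "n = m * p * p"
    using \<open>n = m * p^2\<close> by (simp add: power2_eq_square mult.assoc)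
  have roots: "w ^ n = 1" "w' ^ (m * p) = 1" "w'' ^ p = 1"
    using assms by (auto simp: primitive_root_of_unity_def)
  then have w'': "w'' ^ (m * p) = 1"
    by (metis mult.commute power_mult power_one)
  \<comment> \<open>The exponent \<open>m * p\<close> is a multiple of the orders of both
    \<open>w'\<close> and \<open>w''\<close>.\<close>
  have K_ones: "?K $$ (i, j) ^ (m * p) = 1" if "i < n" "j < n" for i j
    using that roots w'' unfolding n
    by (intro kronecker_power[of _ "m * p" _ p] fourier_mat_power) (auto simp: fourier_mat_def)
  have F: "hadamard_of_order n n ?F"
    using assms roots by (simp add: hadamard_of_order_def hadamard_fourier_mat fourier_mat_power)
  have "?K $$ (i, j) ^ n = 1" if "i < n" "j < n" for i j
    using K_ones[OF that] by (metis n power_mult power_one)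
  then have K: "hadamard_of_order n n ?K"
    unfolding hadamard_of_order_def using assms(6,7)
    by (auto simp: n intro!: hadamard_kronecker hadamard_fourier_mat)
  \<comment> \<open>Here \<open>p \<noteq> 1\<close> enters: \<open>m * p\<close> lies strictly
    below the order \<open>n\<close> of \<open>w\<close>, so \<open>w ^ (m * p)\<close> is a
    nontrivial root of unity.\<close>
  have less: "0 < m * p" "m * p < n"
    using assms(1-3) by (auto simp: n)
  then have "1 < n"
    by linarith
  have "(w ^ (m * p)) ^ n = 1"
    using roots by (metis mult.commute power_mult power_one)
  moreover have "w ^ (m * p) \<noteq> 1"
    using assms(5) less by (auto simp: primitive_root_of_unity_def)
  ultimately have "(\<Sum>l<n. (w ^ (m * p)) ^ l) = 0"
    by (rule sum_powers_root_of_unity)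
  \<comment> \<open>Column 0 of the Fourier matrix consists of ones, so the inner product with the
    powered column 1 is a geometric sum.\<close>
  moreover have "(\<Sum>l<n. cnj (?F $$ (l, 0) ^ (m * p)) * ?F $$ (l, 1) ^ (m * p))
      = (\<Sum>l<n. (w ^ (m * p)) ^ l)"
    using \<open>1 < n\<close> by (intro sum.cong) (simp_all add: fourier_mat_def mult.commute flip: power_mult)
  ultimately have "(\<Sum>l<n. cnj (?F $$ (l, 0) ^ (m * p)) * ?F $$ (l, 1) ^ (m * p)) = 0"
    by simp
  then have not_strong: "\<not> strongly_quantum_equivalent TYPE('a) n ?F ?K"
    using less \<open>1 < n\<close> K_ones F K
    by (intro not_strongly_quantum_equivalent_if_power_ones[where k = "m * p" and a = 0 and b = 1])
      (auto simp: hadamard_of_order_def hadamard_iff)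
  moreover have "\<not> quantum_equivalent TYPE('a) n n ?F ?K"
    using not_strong
    by (auto simp: quantum_equivalent_def strongly_quantum_equivalent_def order_quantum_reflection_def)
  ultimately show ?thesis
    using F K by blast
qed

end
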